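(* Let $\mathcal K$ be a real Hilbert space with a finite orthogonal decomposition $\mathcal K=H_1\oplus\cdots\oplus H_m$ into closed subspaces, and let $T=\nabla\Psi$ with $\Psi\in C^1(\mathcal K)$ real-valued. (i) The exact dependency digraph of $T$ with respect to this decomposition is symmetric: for $i\neq j$, $i\to j$ if and only if $j\to i$. Hence it may be identified with an undirected graph on $\{1,\dots,m\}$. (ii) Let $C_1,\dots,C_r$ be the connected components of this graph and let $K_\alpha=\bigoplus_{i\in C_\alpha}H_i$. Then there are $C^1$ functions $\Psi_\alpha:K_\alpha\to\mathbb R$ ($1\le\alpha\le r$) and a constant $C\in\mathbb R$ such that for all $x\in\mathcal K$ $$\Psi(x)=C+\sum_{\alpha=1}^r\Psi_\alpha(P_{K_\alpha}x)\qquad\text{and}\qquad T(x)=\bigoplus_{\alpha=1}^r\nabla\Psi_\alpha(P_{K_\alpha}x).$$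
   Context: For a closed linear subspace $M\subset\mathcal K$, $P_M$ is the orthogonal projection onto $M$. For a map $T:\mathcal K\to\mathcal K$ and closed subspaces $M,N$, write $M\not\rightsquigarrow_T N$ if $P_NT(x+h)=P_NT(x)$ for all $x\in\mathcal K$, $h\in M$. The exact dependency digraph of $T$ with respect to $\mathcal K=H_1\oplus\cdots\oplus H_m$ has vertex set $\{1,\dots,m\}$ and, for $i\ne j$, an edge $i\to j$ exactly when $H_i\not\rightsquigarrow_T H_j$ fails. *)

theory Defs
  imports "HOL-Analysis.Analysis" "Graph_Theory.Graph_Theory"
begin

hide_const (open) Digraph_Component.connected

definition orth_proj :: "'a::real_inner set \<Rightarrow> 'a \<Rightarrow> 'a" where
  "orth_proj M x = (THE p. p \<in> M \<and> x - p \<in> M\<^sup>\<bottom>)"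

definition orthogonal_decomposition :: "nat \<Rightarrow> (nat \<Rightarrow> 'a::real_inner set) \<Rightarrow> bool" where
  "orthogonal_decomposition m H \<longleftrightarrow>
     (\<forall>i\<in>{1..m}. subspace (H i) \<and> closed (H i)) \<and>
     (\<forall>i\<in>{1..m}. \<forall>j\<in>{1..m}. i \<noteq> j \<longrightarrow> (\<forall>x\<in>H i. \<forall>y\<in>H j. orthogonal x y)) \<and>
     (\<forall>x. \<exists>h. (\<forall>i\<in>{1..m}. h i \<in> H i) \<and> x = (\<Sum>i\<in>{1..m}. h i))"

definition subspace_sum :: "(nat \<Rightarrow> 'a::real_vector set) \<Rightarrow> nat set \<Rightarrow> 'a set" where
  "subspace_sum H I = {\<Sum>i\<in>I. h i | h. \<forall>i\<in>I. h i \<in> H i}"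

definition not_influences :: "('a::real_inner \<Rightarrow> 'a) \<Rightarrow> 'a set \<Rightarrow> 'a set \<Rightarrow> bool" where
  "not_influences T M N \<longleftrightarrow> (\<forall>x. \<forall>h\<in>M. orth_proj N (T (x + h)) = orth_proj N (T x))"

definition dependency_digraph ::
    "('a::real_inner \<Rightarrow> 'a) \<Rightarrow> nat \<Rightarrow> (nat \<Rightarrow> 'a set) \<Rightarrow> (nat, nat \<times> nat) pre_digraph" where
  "dependency_digraph T m H = with_proj
     \<lparr> pverts = {1..m},
       parcs = {(i, j). i \<in> {1..m} \<and> j \<in> {1..m} \<and> i \<noteq> j \<and> \<not> not_influences T (H i) (H j)} \<rparr>"

(* Digraph_Component.connected ignores the orientation of the arcs, so for a symmetric
   digraph these are the vertex sets of the connected components of the undirected graph. *)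
definition graph_components :: "('v, 'e) pre_digraph \<Rightarrow> 'v set set" where
  "graph_components G = verts ` {C. pre_digraph.max_subgraph G Digraph_Component.connected C}"

(* Meant for a closed subspace K; only the values of f on K matter. D x is the Frechet
   derivative on K only after restriction to K; taking it on the whole space is no loss,
   since a derivative on K extends by composition with the projection onto K. *)
definition C1_on :: "'a::real_normed_vector set \<Rightarrow> ('a \<Rightarrow> real) \<Rightarrow> bool" where
  "C1_on K f \<longleftrightarrow> (\<exists>D :: 'a \<Rightarrow> 'a \<Rightarrow>\<^sub>L real.
     (\<forall>x\<in>K. (f has_derivative blinfun_apply (D x)) (at x within K)) \<and> continuous_on K D)"

(* The gradient of f at x in the Hilbert space K, a closed subspace of the ambient one.
   Requiring g in K makes g unique. *)
definition has_gradient_in ::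
    "'a::real_inner set \<Rightarrow> ('a \<Rightarrow> real) \<Rightarrow> 'a \<Rightarrow> 'a \<Rightarrow> bool" where
  "has_gradient_in K f x g \<longleftrightarrow> g \<in> K \<and> (f has_derivative (\<lambda>h. h \<bullet> g)) (at x within K)"

lemma has_gradient_in_UNIV: "has_gradient_in UNIV f x g \<longleftrightarrow> GDERIV f x :> g"
  by (simp add: has_gradient_in_def gderiv_def)

end

theory Submission
  imports Defs
begin

text \<open>
  The symmetry of influence is the symmetry of the second difference
  \<open>\<Psi> (x + h + k) - \<Psi> (x + h) - \<Psi> (x + k) + \<Psi> x\<close>, which takes the place of the
  Hessian because \<open>\<Psi>\<close> need not be twice differentiable.  Since \<open>T\<close> is the gradient of \<open>\<Psi>\<close>, integrating along
  \<open>k\<close> shows that \<open>M\<close> does not influence \<open>N\<close> under \<open>T\<close> exactly when this difference vanishes for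
  all \<open>h \<in> M\<close> and \<open>k \<in> N\<close> (\<open>not_influences_iff_second_difference\<close>), a condition in which \<open>M\<close>
  and \<open>N\<close> play the same part.

  For the splitting, let \<open>P\<close> be the projection onto the sum \<open>K\<close> of the subspaces indexed by one
  component.  No subspace outside the component influences one inside, so changing \<open>x\<close> outside
  \<open>K\<close> does not affect the \<open>K\<close>-part of the gradient: \<open>P (T x) = P (T (P x))\<close>
  (\<open>not_influences_subspace_sum\<close>).  Now take \<open>\<Psi>\<close> itself, restricted to
  \<open>K\<close>, as the summand belonging to \<open>K\<close>; its gradient within \<open>K\<close> is \<open>P \<circ> T\<close>
  (\<open>has_gradient_in_orth_proj\<close>).  The components partition the
  index set, so the projections \<open>P\<close> add up to the identity.  Hence these gradients add up to \<open>T\<close>,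
  and \<open>\<Psi>\<close> minus the sum of the summands has zero derivative, so it is constant.
\<close>

section \<open>Orthogonal projections\<close>

text \<open>
  This is the property of a subspace that makes \<^const>\<open>orth_proj\<close> meaningful.  For sums of
  members of an orthogonal decomposition it can be read off from the decomposition, without
  the projection theorem for closed subspaces.
\<close>
definition orthogonally_complemented :: "'a::real_inner set \<Rightarrow> bool" where
  "orthogonally_complemented M \<longleftrightarrow> subspace M \<and> (\<forall>x. \<exists>p\<in>M. x - p \<in> M\<^sup>\<bottom>)"

lemma orth_proj_eqI:
  assumes M: "subspace M" and p: "p \<in> M" and res: "x - p \<in> M\<^sup>\<bottom>"
  shows "orth_proj M x = p"
  unfolding orth_proj_def
proof (rule the_equality)
  fix q assume q: "q \<in> M \<and> x - q \<in> M\<^sup>\<bottom>"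
  have d: "q - p \<in> M"
    using M p q by (simp add: subspace_diff)
  have "(q - p) \<bullet> (x - p) = 0" "(q - p) \<bullet> (x - q) = 0"
    using d res q by (auto simp: orthogonal_comp_def orthogonal_def)
  then have "(q - p) \<bullet> (q - p) = 0"
    by (simp add: inner_diff_right)
  then show "q = p"
    by simp
qed (use p res in simp)

context
  fixes M :: "'a::real_inner set"
  assumes M: "orthogonally_complemented M"
begin

lemma orth_proj_in: "orth_proj M x \<in> M"
  and orth_proj_residual: "x - orth_proj M x \<in> M\<^sup>\<bottom>"
proof -
  obtain p where "p \<in> M" "x - p \<in> M\<^sup>\<bottom>"
    using M by (auto simp: orthogonally_complemented_def)
  moreover from this have "orth_proj M x = p"
    using M by (intro orth_proj_eqI) (auto simp: orthogonally_complemented_def)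
  ultimately show "orth_proj M x \<in> M" "x - orth_proj M x \<in> M\<^sup>\<bottom>"
    by auto
qed

lemma inner_orth_proj: "k \<in> M \<Longrightarrow> k \<bullet> orth_proj M x = k \<bullet> x"
  using orth_proj_residual[of x]
  by (auto simp: orthogonal_comp_def orthogonal_def inner_diff_right)

lemma orth_proj_self_adjoint: "orth_proj M x \<bullet> y = x \<bullet> orth_proj M y"
  by (metis inner_commute inner_orth_proj orth_proj_in)

lemma orth_proj_id: "x \<in> M \<Longrightarrow> orth_proj M x = x"
  using M by (intro orth_proj_eqI)
    (auto simp: orthogonally_complemented_def orthogonal_comp_def orthogonal_def)

lemma orth_proj_eq_iff: "orth_proj M u = orth_proj M v \<longleftrightarrow> (\<forall>k\<in>M. k \<bullet> u = k \<bullet> v)"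
proof
  assume "orth_proj M u = orth_proj M v"
  then show "\<forall>k\<in>M. k \<bullet> u = k \<bullet> v"
    by (metis inner_orth_proj)
next
  assume eq: "\<forall>k\<in>M. k \<bullet> u = k \<bullet> v"
  have "k \<bullet> (u - orth_proj M v) = 0" if "k \<in> M" for k
    using eq that by (simp add: inner_diff_right inner_orth_proj)
  then show "orth_proj M u = orth_proj M v"
    using M orth_proj_in by (intro orth_proj_eqI)
      (auto simp: orthogonally_complemented_def orthogonal_comp_def orthogonal_def)
qed

lemma bounded_linear_orth_proj: "bounded_linear (orth_proj M)"
proof (rule bounded_linear_intro[where K = 1])
  have sub: "subspace M"
    using M by (simp add: orthogonally_complemented_def)
  show "orth_proj M (x + y) = orth_proj M x + orth_proj M y" for x y
    using sub by (intro orth_proj_eqI)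
      (auto simp: subspace_add orth_proj_in orthogonal_comp_def orthogonal_def
        inner_diff_right inner_add_right inner_orth_proj)
  show "orth_proj M (r *\<^sub>R x) = r *\<^sub>R orth_proj M x" for r x
    using sub by (intro orth_proj_eqI)
      (auto simp: subspace_scale orth_proj_in orthogonal_comp_def orthogonal_def
        inner_diff_right inner_orth_proj)
  show "norm (orth_proj M x) \<le> norm x * 1" for x
  proof (cases "orth_proj M x = 0")
    case False
    have "norm (orth_proj M x) * norm (orth_proj M x) = orth_proj M x \<bullet> x"
      using inner_orth_proj[OF orth_proj_in, of x x]
      by (simp add: power2_norm_eq_inner flip: power2_eq_square)
    also have "\<dots> \<le> norm (orth_proj M x) * norm x"
      by (rule norm_cauchy_schwarz)
    finally show ?thesis
      using False by simp
  qed simp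
qed

end

section \<open>Sums of members of an orthogonal decomposition\<close>

lemma subspace_subspace_sum:
  assumes "\<And>i. i \<in> I \<Longrightarrow> subspace (H i)"
  shows "subspace (subspace_sum H I)"
  unfolding subspace_def
proof (intro conjI ballI allI)
  show "0 \<in> subspace_sum H I"
    using assms by (auto simp: subspace_sum_def subspace_0 intro!: exI[of _ "\<lambda>_. 0"])
next
  fix x y assume "x \<in> subspace_sum H I" "y \<in> subspace_sum H I"
  then obtain f g where "x = sum f I" "y = sum g I" "\<forall>i\<in>I. f i \<in> H i" "\<forall>i\<in>I. g i \<in> H i"
    by (auto simp: subspace_sum_def)
  then show "x + y \<in> subspace_sum H I"
    using assms
    by (auto simp: subspace_sum_def sum.distrib subspace_add intro!: exI[of _ "\<lambda>i. f i + g i"])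
next
  fix c x assume "x \<in> subspace_sum H I"
  then obtain f where "x = sum f I" "\<forall>i\<in>I. f i \<in> H i"
    by (auto simp: subspace_sum_def)
  then show "c *\<^sub>R x \<in> subspace_sum H I"
    using assms
    by (auto simp: subspace_sum_def scaleR_sum_right subspace_scale
        intro!: exI[of _ "\<lambda>i. c *\<^sub>R f i"])
qed

lemma sum_in_subspace_sum: "(\<And>i. i \<in> I \<Longrightarrow> h i \<in> H i) \<Longrightarrow> sum h I \<in> subspace_sum H I"
  by (auto simp: subspace_sum_def)

lemma subspace_sum_singleton: "subspace_sum H {i} = H i"
proof
  show "H i \<subseteq> subspace_sum H {i}"
  proof
    fix x assume "x \<in> H i"
    then show "x \<in> subspace_sum H {i}"
      using sum_in_subspace_sum[of "{i}" "\<lambda>_. x" H] by simp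
  qed
qed (auto simp: subspace_sum_def)

context
  fixes m :: nat and H :: "nat \<Rightarrow> 'a::real_inner set"
  assumes decomp: "orthogonal_decomposition m H"
begin

lemma decomposition_residual_orthogonal:
  assumes I: "I \<subseteq> {1..m}" and h: "\<And>i. i \<in> {1..m} \<Longrightarrow> h i \<in> H i"
  shows "(\<Sum>i\<in>{1..m}. h i) - (\<Sum>i\<in>I. h i) \<in> (subspace_sum H I)\<^sup>\<bottom>"
proof -
  have rest: "(\<Sum>i\<in>{1..m}. h i) - (\<Sum>i\<in>I. h i) = (\<Sum>i\<in>{1..m}-I. h i)"
    using I by (simp add: sum_diff)
  have "sum f I \<bullet> (\<Sum>i\<in>{1..m}-I. h i) = 0" if f: "\<forall>i\<in>I. f i \<in> H i" for f
  proof -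
    have "f i \<bullet> h j = 0" if "i \<in> I" "j \<in> {1..m} - I" for i j
    proof -
      have "i \<in> {1..m}" "j \<in> {1..m}" "i \<noteq> j" "f i \<in> H i" "h j \<in> H j"
        using that I f h by auto
      then show ?thesis
        using decomp unfolding orthogonal_decomposition_def orthogonal_def by blast
    qed
    then show ?thesis
      by (simp add: inner_sum_left inner_sum_right)
  qed
  then show ?thesis
    unfolding rest by (auto simp: orthogonal_comp_def orthogonal_def subspace_sum_def)
qed

lemma decomposition_component:
  obtains h where "\<And>i. i \<in> {1..m} \<Longrightarrow> h i \<in> H i" "x = (\<Sum>i\<in>{1..m}. h i)"
proof -
  have "\<exists>h. (\<forall>i\<in>{1..m}. h i \<in> H i) \<and> x = (\<Sum>i\<in>{1..m}. h i)"
    using decomp by (simp add: orthogonal_decomposition_def)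
  then show thesis
    using that by blast
qed

lemma decomposition_subspace: "i \<in> {1..m} \<Longrightarrow> subspace (H i)"
  using decomp by (simp add: orthogonal_decomposition_def)

lemma orthogonally_complemented_subspace_sum:
  assumes I: "I \<subseteq> {1..m}"
  shows "orthogonally_complemented (subspace_sum H I)"
  unfolding orthogonally_complemented_def
proof (intro conjI allI)
  show "subspace (subspace_sum H I)"
    using I by (intro subspace_subspace_sum decomposition_subspace) auto
  fix x
  obtain h where h: "\<And>i. i \<in> {1..m} \<Longrightarrow> h i \<in> H i" "x = (\<Sum>i\<in>{1..m}. h i)"
    using decomposition_component[of x] by blast
  have "sum h I \<in> subspace_sum H I"
    using h(1) I by (intro sum_in_subspace_sum) blast
  then show "\<exists>p\<in>subspace_sum H I. x - p \<in> (subspace_sum H I)\<^sup>\<bottom>"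
    using decomposition_residual_orthogonal[OF I h(1)] h(2) by blast
qed

lemma orthogonally_complemented_member:
  "i \<in> {1..m} \<Longrightarrow> orthogonally_complemented (H i)"
  using orthogonally_complemented_subspace_sum[of "{i}"] by (simp add: subspace_sum_singleton)

lemma orth_proj_subspace_sum:
  assumes I: "I \<subseteq> {1..m}" and h: "\<And>i. i \<in> {1..m} \<Longrightarrow> h i \<in> H i"
  shows "orth_proj (subspace_sum H I) (\<Sum>i\<in>{1..m}. h i) = (\<Sum>i\<in>I. h i)"
proof (rule orth_proj_eqI)
  show "subspace (subspace_sum H I)"
    using I by (intro subspace_subspace_sum decomposition_subspace) auto
  show "sum h I \<in> subspace_sum H I"
    using h I by (intro sum_in_subspace_sum) blast
qed (rule decomposition_residual_orthogonal[OF I h])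

lemma orth_proj_complement_in:
  assumes I: "I \<subseteq> {1..m}"
  shows "x - orth_proj (subspace_sum H I) x \<in> subspace_sum H ({1..m} - I)"
proof -
  obtain h where h: "\<And>i. i \<in> {1..m} \<Longrightarrow> h i \<in> H i" "x = (\<Sum>i\<in>{1..m}. h i)"
    using decomposition_component[of x] by blast
  have "x - orth_proj (subspace_sum H I) x = (\<Sum>i\<in>{1..m}-I. h i)"
    unfolding h(2) using I orth_proj_subspace_sum[OF I h(1)] by (simp add: sum_diff)
  moreover have "(\<Sum>i\<in>{1..m}-I. h i) \<in> subspace_sum H ({1..m} - I)"
    using h(1) by (intro sum_in_subspace_sum) blast
  ultimately show ?thesis
    by simp
qed

lemma sum_orth_proj_partition:
  assumes union: "\<Union>A = {1..m}" and disjoint: "\<And>I J. I \<in> A \<Longrightarrow> J \<in> A \<Longrightarrow> I \<noteq> J \<Longrightarrow> I \<inter> J = {}"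
  shows "(\<Sum>I\<in>A. orth_proj (subspace_sum H I) x) = x"
proof -
  obtain h where h: "\<And>i. i \<in> {1..m} \<Longrightarrow> h i \<in> H i" "x = (\<Sum>i\<in>{1..m}. h i)"
    using decomposition_component[of x] by blast
  have sub: "I \<subseteq> {1..m}" if "I \<in> A" for I
    using that union by blast
  have "(\<Sum>I\<in>A. orth_proj (subspace_sum H I) x) = (\<Sum>I\<in>A. sum h I)"
    unfolding h(2) using orth_proj_subspace_sum[OF sub h(1)] by (intro sum.cong) auto
  also have "\<dots> = sum h (\<Union>A)"
    using sub disjoint finite_subset[of _ "{1..m}"]
    by (subst sum.Union_disjoint) (auto simp: comp_def)
  finally show ?thesis
    using union h(2) by simp
qed

end

section \<open>Influence under a gradient map\<close>

lemma not_influences_iff_inner: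
  assumes "orthogonally_complemented N"
  shows "not_influences T M N \<longleftrightarrow> (\<forall>x. \<forall>h\<in>M. \<forall>k\<in>N. k \<bullet> T (x + h) = k \<bullet> T x)"
  by (simp add: not_influences_def orth_proj_eq_iff[OF assms])

lemma has_real_derivative_along_line:
  assumes "\<forall>x. GDERIV \<Psi> x :> T x"
  shows "((\<lambda>t. \<Psi> (x + t *\<^sub>R k)) has_real_derivative k \<bullet> T (x + t *\<^sub>R k)) (at t)"
proof -
  have "((\<lambda>t. x + t *\<^sub>R k) has_derivative (\<lambda>s. s *\<^sub>R k)) (at t)"
    by (auto intro!: derivative_eq_intros)
  moreover have "(\<Psi> has_derivative (\<lambda>h. h \<bullet> T (x + t *\<^sub>R k))) (at (x + t *\<^sub>R k))"
    using assms by (simp add: gderiv_def)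
  ultimately have
    "((\<lambda>t. \<Psi> (x + t *\<^sub>R k)) has_derivative (\<lambda>s. (s *\<^sub>R k) \<bullet> T (x + t *\<^sub>R k))) (at t)"
    by (rule has_derivative_compose)
  then show ?thesis
    by (rule has_derivative_imp_has_field_derivative) simp
qed

text \<open>
  Fix \<open>x\<close>, \<open>h\<close> and \<open>k\<close>.  Along the line in direction \<open>k\<close>, the function
  \<open>t \<mapsto> \<Psi> (x + h + t k) - \<Psi> (x + t k)\<close> has the derivative \<open>k \<bullet> (T (x + h + t k) - T (x + t k))\<close>.
  Non-influence says that this derivative is always zero, and the vanishing of the second
  difference says that the function is constant.
\<close>
lemma not_influences_iff_second_difference:
  assumes N: "orthogonally_complemented N" and grad: "\<forall>x. GDERIV \<Psi> x :> T x"
  shows "not_influences T M N \<longleftrightarrow>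
    (\<forall>x. \<forall>h\<in>M. \<forall>k\<in>N. \<Psi> (x + h + k) - \<Psi> (x + h) - \<Psi> (x + k) + \<Psi> x = 0)"
    (is "_ \<longleftrightarrow> ?R")
proof -
  define f where "f x h k t = \<Psi> (x + h + t *\<^sub>R k) - \<Psi> (x + t *\<^sub>R k)" for x h k t
  have deriv: "(f x h k has_real_derivative
      k \<bullet> T (x + h + t *\<^sub>R k) - k \<bullet> T (x + t *\<^sub>R k)) (at t)" for x h k t
    unfolding f_def by (intro DERIV_diff has_real_derivative_along_line grad)
  show ?thesis
  proof
    assume indep: "not_influences T M N"
    show ?R
    proof (intro allI ballI)
      fix x h k assume h: "h \<in> M" and k: "k \<in> N"
      have "k \<bullet> T (x + h + t *\<^sub>R k) = k \<bullet> T (x + t *\<^sub>R k)" for t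
        using indep[unfolded not_influences_iff_inner[OF N], rule_format, OF h k,
            of "x + t *\<^sub>R k"]
        by (simp add: algebra_simps)
      then have "(f x h k has_real_derivative 0) (at t)" for t
        using deriv[of x h k t] by simp
      then have "f x h k 1 = f x h k 0"
        using DERIV_isconst_all by blast
      then show "\<Psi> (x + h + k) - \<Psi> (x + h) - \<Psi> (x + k) + \<Psi> x = 0"
        by (simp add: f_def)
    qed
  next
    assume diff: ?R
    show "not_influences T M N"
      unfolding not_influences_iff_inner[OF N]
    proof (intro allI ballI)
      fix x h k assume h: "h \<in> M" and k: "k \<in> N"
      have "subspace N"
        using N by (simp add: orthogonally_complemented_def)
      then have "f x h k t = \<Psi> (x + h) - \<Psi> x" for t
        using diff[rule_format, OF h, of "t *\<^sub>R k" x] k by (simp add: f_def subspace_scale)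
      then have "f x h k = (\<lambda>t. \<Psi> (x + h) - \<Psi> x)"
        by blast
      then have "(f x h k has_real_derivative 0) (at 0)"
        by simp
      then show "k \<bullet> T (x + h) = k \<bullet> T x"
        using DERIV_unique[OF deriv[of x h k 0]] by fastforce
    qed
  qed
qed

lemma not_influences_commute:
  assumes M: "orthogonally_complemented M" and N: "orthogonally_complemented N"
    and grad: "\<forall>x. GDERIV \<Psi> x :> T x"
  shows "not_influences T M N \<longleftrightarrow> not_influences T N M"
proof -
  have swap: "\<Psi> (x + h + k) - \<Psi> (x + h) - \<Psi> (x + k) + \<Psi> x
      = \<Psi> (x + k + h) - \<Psi> (x + k) - \<Psi> (x + h) + \<Psi> x" for x h k
    by (simp add: add_ac)
  show ?thesis
    unfolding not_influences_iff_second_difference[OF M grad]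
      not_influences_iff_second_difference[OF N grad]
    by (subst swap) blast
qed

text \<open>
  A displacement in a sum of subspaces is made in finitely many steps, one for each summand, and
  none of these steps is visible to any of the \<open>H i\<close>.
\<close>
lemma not_influences_subspace_sum:
  assumes fin: "finite J"
    and I: "orthogonally_complemented (subspace_sum H I)"
      "\<And>i. i \<in> I \<Longrightarrow> orthogonally_complemented (H i)"
    and indep: "\<And>i j. i \<in> I \<Longrightarrow> j \<in> J \<Longrightarrow> not_influences T (H j) (H i)"
  shows "not_influences T (subspace_sum H J) (subspace_sum H I)"
proof -
  have inv: "k \<bullet> T (x + sum f J) = k \<bullet> T x"
    if i: "i \<in> I" and k: "k \<in> H i" and f: "\<forall>j\<in>J. f j \<in> H j" for i k x f
    using fin indep f
  proof (induction J arbitrary: x)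
    case (insert j J)
    have "k \<bullet> T (x + f j + sum f J) = k \<bullet> T (x + f j)"
      using insert by auto
    also have "\<dots> = k \<bullet> T x"
    proof -
      have "not_influences T (H j) (H i)" "f j \<in> H j"
        using insert.prems i by auto
      then show ?thesis
        using k by (simp add: not_influences_iff_inner I(2) i)
    qed
    finally show ?case
      using insert.hyps by (simp add: add.assoc)
  qed simp
  have "sum g I \<bullet> T (x + sum f J) = sum g I \<bullet> T x"
    if "\<forall>i\<in>I. g i \<in> H i" "\<forall>j\<in>J. f j \<in> H j" for f g x
    using inv that by (auto simp: inner_sum_left intro!: sum.cong)
  then show ?thesis
    unfolding not_influences_iff_inner[OF I(1)] by (auto simp: subspace_sum_def)
qed

section \<open>Components of a symmetric digraph\<close>

lemma arc_mono_connected: "arc_mono Digraph_Component.connected"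
  unfolding arc_mono_def
proof (intro allI impI)
  fix C D :: "('v, 'e) pre_digraph"
  assume a: "Digraph_Component.connected C \<and> subgraph C D \<and> verts C = verts D"
  then interpret D: wf_digraph D
    by (auto simp: subgraph_def)
  show "Digraph_Component.connected D"
    using a by (intro D.connected_spanning_imp_connected[of C]) (auto simp: spanning_def)
qed

lemma (in wf_digraph) strongly_connected_imp_connected:
  "strongly_connected G \<Longrightarrow> Digraph_Component.connected G"
  by (auto simp: strongly_connected_def intro!: connectedI reachable_mk_symmetricI)

text \<open>
  A maximal connected subgraph is induced, hence again symmetric, and in a symmetric digraph
  the two notions of connectedness agree.
\<close>
lemma (in wf_digraph) graph_components_symmetric:
  assumes sym: "symmetric G"
  shows "graph_components G = sccs_verts"
proof -
  have strong: "strongly_connected C"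
    if "Digraph_Component.connected C" "induced_subgraph C G" for C
    using that wf_digraph.symmetric_connected_imp_strongly_connected[of C]
      induced_graph_imp_symmetric[OF sym] wf_digraphI_induced by blast
  have weak: "Digraph_Component.connected C" if "strongly_connected C" "subgraph C G" for C
    using that wf_digraph.strongly_connected_imp_connected by (auto simp: subgraph_def)
  have "max_subgraph Digraph_Component.connected C \<longleftrightarrow> max_subgraph strongly_connected C" for C
  proof
    assume C: "max_subgraph Digraph_Component.connected C"
    then have "strongly_connected C"
      using arc_mono_connected induced_subgraphI_arc_mono max_subgraph_prop strong by blast
    with C weak show "max_subgraph strongly_connected C"
      by (auto simp: max_subgraph_def)
  next
    assume C: "max_subgraph strongly_connected C"
    show "max_subgraph Digraph_Component.connected C"
    proof (rule max_subgraphI)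
      show "subgraph C G" "Digraph_Component.connected C"
        using C weak by (auto simp: max_subgraph_def)
    next
      fix D assume D: "C \<noteq> D" "subgraph C D" "subgraph D G"
      show "\<not> Digraph_Component.connected D"
      proof
        assume conn: "Digraph_Component.connected D"
        have ind: "induced_subgraph (G \<restriction> verts D) G" "subgraph D (G \<restriction> verts D)"
          using D(3) by (auto simp: subgraph_induce_subgraphI2 subgraph_imp_subverts)
        then have "Digraph_Component.connected (G \<restriction> verts D)"
          using conn arc_mono_connected unfolding arc_mono_def
          by (metis induce_subgraph_verts)
        then have "strongly_connected (G \<restriction> verts D)"
          using ind strong by blast
        moreover have "subgraph C (G \<restriction> verts D)"
          using D(2) ind(2) subgraph_trans by blast
        ultimately have "C = G \<restriction> verts D"
          using C induced_imp_subgraph[OF ind(1)] unfolding max_subgraph_def by metis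
        then have "subgraph D C"
          using ind(2) by simp
        then have "C = D"
          using D(2) by (auto simp: subgraph_def compatible_def)
        with D(1) show False ..
      qed
    qed
  qed
  then show ?thesis
    by (simp add: graph_components_def sccs_verts_conv sccs_altdef2)
qed

section \<open>The decomposition of the potential\<close>

lemma wf_digraph_dependency_digraph: "wf_digraph (dependency_digraph T m H)"
  by unfold_locales (auto simp: dependency_digraph_def)

lemma dependency_digraph_arc_iff:
  "i \<rightarrow>\<^bsub>dependency_digraph T m H\<^esub> j \<longleftrightarrow>
    i \<in> {1..m} \<and> j \<in> {1..m} \<and> i \<noteq> j \<and> \<not> not_influences T (H i) (H j)"
  by (simp add: dependency_digraph_def)

text \<open>
  On \<open>M\<close> the function coincides with its composition with the projection onto \<open>M\<close>, and the
  chain rule puts the adjoint of that projection, which is the projection itself, in front of the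
  ambient gradient.
\<close>
lemma has_gradient_in_orth_proj:
  assumes M: "orthogonally_complemented M" and f: "GDERIV f y :> v" and y: "y \<in> M"
  shows "has_gradient_in M f y (orth_proj M v)"
proof -
  have "(f has_derivative (\<lambda>h. h \<bullet> v)) (at (orth_proj M y))"
    using f y by (simp add: gderiv_def orth_proj_id[OF M])
  then have "((\<lambda>z. f (orth_proj M z)) has_derivative (\<lambda>h. orth_proj M h \<bullet> v)) (at y within M)"
    by (rule has_derivative_compose[OF bounded_linear_imp_has_derivative[OF
          bounded_linear_orth_proj[OF M]]])
  then have "(f has_derivative (\<lambda>h. orth_proj M h \<bullet> v)) (at y within M)"
    by (rule has_derivative_transform[rotated 2]) (use y in \<open>auto simp: orth_proj_id[OF M]\<close>)
  then show ?thesis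
    by (simp add: has_gradient_in_def orth_proj_in[OF M] orth_proj_self_adjoint[OF M])
qed

theorem theorem3p4:
  fixes H :: "nat \<Rightarrow> 'a::{real_inner, complete_space} set"
    and m :: nat
    and \<Psi> :: "'a \<Rightarrow> real"
    and T :: "'a \<Rightarrow> 'a"
  assumes decomp: "orthogonal_decomposition m H"
    and C1: "C1_on UNIV \<Psi>"
    and grad: "\<forall>x. GDERIV \<Psi> x :> T x"
  shows "(symmetric (dependency_digraph T m H) \<and>
          (\<forall>i\<in>{1..m}. \<forall>j\<in>{1..m}. i \<noteq> j \<longrightarrow>
             (i \<rightarrow>\<^bsub>dependency_digraph T m H\<^esub> j \<longleftrightarrow> j \<rightarrow>\<^bsub>dependency_digraph T m H\<^esub> i))) \<and>
         (\<exists>(\<psi> :: nat set \<Rightarrow> 'a \<Rightarrow> real) (g :: nat set \<Rightarrow> 'a \<Rightarrow> 'a) (c :: real).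
           (\<forall>\<alpha>\<in>graph_components (dependency_digraph T m H).
              C1_on (subspace_sum H \<alpha>) (\<psi> \<alpha>) \<and>
              (\<forall>y\<in>subspace_sum H \<alpha>. has_gradient_in (subspace_sum H \<alpha>) (\<psi> \<alpha>) y (g \<alpha> y))) \<and>
           (\<forall>x. \<Psi> x = c + (\<Sum>\<alpha>\<in>graph_components (dependency_digraph T m H).
                               \<psi> \<alpha> (orth_proj (subspace_sum H \<alpha>) x)) \<and>
                T x = (\<Sum>\<alpha>\<in>graph_components (dependency_digraph T m H).
                               g \<alpha> (orth_proj (subspace_sum H \<alpha>) x))))"
proof -
  let ?G = "dependency_digraph T m H"
  let ?A = "graph_components ?G"
  let ?K = "subspace_sum H"
  let ?P = "\<lambda>\<alpha>. orth_proj (?K \<alpha>)"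
  interpret G: wf_digraph ?G
    by (rule wf_digraph_dependency_digraph)
  have arc_commute: "i \<rightarrow>\<^bsub>?G\<^esub> j \<longleftrightarrow> j \<rightarrow>\<^bsub>?G\<^esub> i" for i j
    unfolding dependency_digraph_arc_iff
    using not_influences_commute[OF orthogonally_complemented_member[OF decomp]
        orthogonally_complemented_member[OF decomp] grad] by blast
  then have sym: "symmetric ?G"
    by (auto simp: symmetric_def intro!: symI)

  have components: "?A = G.sccs_verts"
    by (rule G.graph_components_symmetric[OF sym])
  have verts: "verts ?G = {1..m}"
    by (simp add: dependency_digraph_def)
  have sub: "\<alpha> \<subseteq> {1..m}" if "\<alpha> \<in> ?A" for \<alpha>
    using that G.sccs_verts_subsets verts components by auto
  have union: "\<Union>?A = {1..m}"
    using sub G.scc_of_in_sccs_verts G.in_scc_of_self verts components by blast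
  have disjoint: "\<alpha> \<inter> \<beta> = {}" if "\<alpha> \<in> ?A" "\<beta> \<in> ?A" "\<alpha> \<noteq> \<beta>" for \<alpha> \<beta>
    using that G.sccs_verts_disjoint components by auto
  have outside: "not_influences T (H j) (H i)"
    if "\<alpha> \<in> ?A" "i \<in> \<alpha>" "j \<in> {1..m} - \<alpha>" for \<alpha> i j
  proof (rule ccontr)
    assume "\<not> not_influences T (H j) (H i)"
    moreover have "i \<in> {1..m}" "j \<in> {1..m}" "i \<noteq> j"
      using that sub by blast+
    ultimately have "j \<rightarrow>\<^bsub>?G\<^esub> i"
      by (simp add: dependency_digraph_arc_iff)
    then have "j \<rightarrow>\<^sup>*\<^bsub>?G\<^esub> i" "i \<rightarrow>\<^sup>*\<^bsub>?G\<^esub> j"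
      using arc_commute by (auto intro: G.reachable_adjI)
    then show False
      using that unfolding components G.in_sccs_verts_conv_reachable by blast
  qed

  have compl: "orthogonally_complemented (?K \<alpha>)" if "\<alpha> \<in> ?A" for \<alpha>
    using orthogonally_complemented_subspace_sum[OF decomp] sub that by blast
  \<comment> \<open>Every \<open>x\<close> differs from its projection by a displacement outside the component.\<close>
  have local: "?P \<alpha> (T (?P \<alpha> x)) = ?P \<alpha> (T x)" if \<alpha>: "\<alpha> \<in> ?A" for \<alpha> x
  proof -
    have "not_influences T (?K ({1..m} - \<alpha>)) (?K \<alpha>)"
    proof (rule not_influences_subspace_sum)
      show "orthogonally_complemented (H i)" if "i \<in> \<alpha>" for i
        using that sub[OF \<alpha>] orthogonally_complemented_member[OF decomp] by blast
    qed (use \<alpha> outside compl in auto)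
    then have "?P \<alpha> (T (?P \<alpha> x + (x - ?P \<alpha> x))) = ?P \<alpha> (T (?P \<alpha> x))"
      using orth_proj_complement_in[OF decomp sub[OF \<alpha>]] unfolding not_influences_def by blast
    then show ?thesis
      by simp
  qed
  have T_sum: "T x = (\<Sum>\<alpha>\<in>?A. ?P \<alpha> (T (?P \<alpha> x)))" for x
    using sum_orth_proj_partition[OF decomp union disjoint, of "T x"] local by simp

  have C1_K: "C1_on (?K \<alpha>) \<Psi>" for \<alpha>
  proof -
    obtain D :: "'a \<Rightarrow> 'a \<Rightarrow>\<^sub>L real" where
      D: "\<And>x. (\<Psi> has_derivative blinfun_apply (D x)) (at x)" "continuous_on UNIV D"
      using C1 by (auto simp: C1_on_def)
    then have "(\<Psi> has_derivative blinfun_apply (D x)) (at x within ?K \<alpha>)" for x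
      by (simp add: has_derivative_at_withinI)
    then show ?thesis
      using D(2) continuous_on_subset unfolding C1_on_def by blast
  qed

  \<comment> \<open>The value of \<open>\<Psi>\<close> at \<open>0\<close> is counted once in each summand; the constant corrects this.\<close>
  define R where "R x = \<Psi> x - (\<Sum>\<alpha>\<in>?A. \<Psi> (?P \<alpha> x))" for x
  have "(R has_derivative (\<lambda>h. 0)) (at x)" for x
  proof -
    have summand: "((\<lambda>x. \<Psi> (?P \<alpha> x)) has_derivative (\<lambda>h. ?P \<alpha> h \<bullet> T (?P \<alpha> x))) (at x)"
      if "\<alpha> \<in> ?A" for \<alpha>
      by (rule has_derivative_compose[OF bounded_linear_imp_has_derivative[OF
              bounded_linear_orth_proj[OF compl[OF that]]] grad[unfolded gderiv_def, rule_format]])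
    have "(R has_derivative (\<lambda>h. h \<bullet> T x - (\<Sum>\<alpha>\<in>?A. ?P \<alpha> h \<bullet> T (?P \<alpha> x)))) (at x)"
      unfolding R_def using grad
      by (intro has_derivative_diff has_derivative_sum summand) (auto simp: gderiv_def)
    moreover have "(\<Sum>\<alpha>\<in>?A. ?P \<alpha> h \<bullet> T (?P \<alpha> x)) = h \<bullet> T x" for h
      by (subst T_sum[of x]) (auto simp: inner_sum_right orth_proj_self_adjoint compl intro!: sum.cong)
    ultimately show ?thesis
      by simp
  qed
  then obtain c where "\<And>x. R x = c"
    using has_derivative_zero_constant[of UNIV R] by auto
  then have potential_sum: "\<Psi> x = c + (\<Sum>\<alpha>\<in>?A. \<Psi> (?P \<alpha> x))" for x
    by (metis R_def diff_add_cancel)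

  show ?thesis
  proof (intro conjI exI ballI allI impI)
    show "symmetric ?G"
      by (rule sym)
    show "i \<rightarrow>\<^bsub>?G\<^esub> j \<longleftrightarrow> j \<rightarrow>\<^bsub>?G\<^esub> i" for i j
      by (rule arc_commute)
    show "C1_on (?K \<alpha>) \<Psi>" for \<alpha>
      by (rule C1_K)
    show "has_gradient_in (?K \<alpha>) \<Psi> y (?P \<alpha> (T y))"
      if "\<alpha> \<in> ?A" "y \<in> ?K \<alpha>" for \<alpha> y
      by (rule has_gradient_in_orth_proj[OF compl[OF that(1)] grad[rule_format] that(2)])
    show "\<Psi> x = c + (\<Sum>\<alpha>\<in>?A. \<Psi> (?P \<alpha> x))" for x
      by (rule potential_sum)
    show "T x = (\<Sum>\<alpha>\<in>?A. ?P \<alpha> (T (?P \<alpha> x)))" for x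
      by (rule T_sum)
  qed
qed

end
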